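(* Let $k>8$ be an integer and let $\sigma_1=\cos(\frac{2\pi}{k})+i\sin(\frac{2\pi}{k})$. Then the oriented graph on two vertices with a single arc is, up to isomorphism, the only connected oriented graph $D$ such that $H_{\sigma_1}(D)$ has exactly two distinct eigenvalues.
   Context: An oriented graph $D=(V,A)$ is a loopless directed graph in which for each pair of distinct vertices $u,v$ at most one of $(u,v),(v,u)$ is an arc; write $u\to v$ if $(u,v)\in A$. $D$ is connected if its underlying simple graph is connected. For a complex number $\sigma$ of modulus $1$, the Hermitian adjacency matrix $H_\sigma(D)$ has $(u,v)$-entry $\sigma$ if $u\to v$, $\overline{\sigma}$ if $v\to u$, and $0$ otherwise. *)

theory Defs
  imports
    "Graph_Theory.Graph_Theory"
    "Jordan_Normal_Form.Spectral_Radius"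
begin

text \<open>
  A \<open>pair_digraph\<close> is a finite loopless digraph whose arcs are ordered pairs of vertices,
  so parallel arcs are already excluded.
\<close>

locale oriented_graph = pair_digraph +
  assumes no_opposite_arcs: "(u, v) \<in> parcs G \<Longrightarrow> (v, u) \<notin> parcs G"

text \<open>
  Matrices are indexed by \<open>{0..<n}\<close>, so the vertices are listed explicitly:
  \<open>vs\<close> is meant to be an enumeration of the vertex set without repetition. Different
  enumerations give matrices that are conjugate by a permutation matrix.
\<close>

definition enumerates_verts :: "'a list \<Rightarrow> 'a pair_pre_digraph \<Rightarrow> bool" where
  "enumerates_verts vs D \<longleftrightarrow> distinct vs \<and> set vs = pverts D"

definition hermitian_adjacency_matrix ::
  "complex \<Rightarrow> 'a pair_pre_digraph \<Rightarrow> 'a list \<Rightarrow> complex mat" where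
  "hermitian_adjacency_matrix \<sigma> D vs =
     mat (length vs) (length vs) (\<lambda>(i, j).
       if (vs ! i, vs ! j) \<in> parcs D then \<sigma>
       else if (vs ! j, vs ! i) \<in> parcs D then cnj \<sigma>
       else 0)"

definition single_arc :: "nat pair_pre_digraph" where
  "single_arc = \<lparr> pverts = {0, 1}, parcs = {(0, 1)} \<rparr>"

end

theory Submission
  imports Defs
begin

text \<open>
  A Hermitian matrix \<open>H\<close> with exactly two eigenvalues \<open>a\<close>, \<open>b\<close> satisfies
  \<open>H\<^sup>2 = (a + b) H - a b\<close> with \<open>a + b\<close> real. For non-adjacent \<open>u\<close>, \<open>v\<close> the \<open>(u, v)\<close> entry of
  \<open>H\<^sup>2\<close> is a vanishing sum of terms \<open>\<sigma>\<^sup>2\<close>, \<open>cnj (\<sigma>\<^sup>2)\<close> and \<open>1\<close>, all with positive real part as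
  \<open>k > 8\<close>; so \<open>u\<close> and \<open>v\<close> have no common neighbour, and connectedness makes \<open>D\<close> a tournament.
  For an arc \<open>u \<rightarrow> v\<close> the \<open>(u, v)\<close> entry of \<open>H\<^sup>2\<close> is a real multiple of \<open>\<sigma>\<close>. Multiplying it by
  \<open>cnj \<sigma>\<close>, taking imaginary parts and summing over all arcs gives a combination of the numbers of
  transitive and of cyclic triangles with negative coefficients that vanishes. So there are no
  triangles, and a tournament without triangles has at most two vertices.
\<close>

section \<open>Hermitian matrices with two eigenvalues\<close>

lemma index_mult_mat_sum:
  assumes "A \<in> carrier_mat n n" "B \<in> carrier_mat n n" "i < n" "j < n"
  shows "(A * B) $$ (i,j) = (\<Sum>k<n. A $$ (i,k) * B $$ (k,j))"
  using assms by (auto simp: scalar_prod_def atLeast0LessThan intro!: sum.cong)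

lemma index_mult_mat_vec_sum:
  assumes "A \<in> carrier_mat n n" "v \<in> carrier_vec n" "i < n"
  shows "(A *\<^sub>v v) $ i = (\<Sum>k<n. A $$ (i,k) * v $ k)"
  using assms by (auto simp: scalar_prod_def atLeast0LessThan intro!: sum.cong)

definition hermitian_mat :: "nat \<Rightarrow> complex mat \<Rightarrow> bool" where
  "hermitian_mat n A \<longleftrightarrow>
     A \<in> carrier_mat n n \<and> (\<forall>i<n. \<forall>j<n. A $$ (i,j) = cnj (A $$ (j,i)))"

lemma eigenvalueE:
  assumes "eigenvalue A e" "A \<in> carrier_mat n n"
  obtains v where "v \<in> carrier_vec n" "v \<noteq> 0\<^sub>v n" "A *\<^sub>v v = e \<cdot>\<^sub>v v"
  using assms unfolding eigenvalue_def eigenvector_def by (metis carrier_matD(1))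

lemma eigenvalueI:
  assumes "A \<in> carrier_mat n n" "v \<in> carrier_vec n" "v \<noteq> 0\<^sub>v n" "A *\<^sub>v v = e \<cdot>\<^sub>v v"
  shows "eigenvalue A e"
  using assms unfolding eigenvalue_def eigenvector_def by (metis carrier_matD(1))

lemma hermitian_matD:
  assumes "hermitian_mat n A" "i < n" "j < n"
  shows "cnj (A $$ (i,j)) = A $$ (j,i)"
proof -
  have "\<forall>i<n. \<forall>j<n. A $$ (i,j) = cnj (A $$ (j,i))"
    using assms(1) unfolding hermitian_mat_def by (rule conjunct2)
  with assms(2,3) have "A $$ (j,i) = cnj (A $$ (i,j))" by (elim allE impE)
  thus ?thesis ..
qed

text \<open>The form \<open>Q\<close> is the conjugate transpose of \<open>v\<close> times
  \<open>A\<close> times \<open>v\<close>. It equals \<open>e * S\<close> with \<open>S\<close> the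
  squared norm of \<open>v\<close>, and swapping the summation indices shows that it is its own
  conjugate.\<close>

lemma hermitian_eigenvalue_real:
  assumes H: "hermitian_mat n A" and e: "eigenvalue A e"
  shows "cnj e = e"
proof -
  have A: "A \<in> carrier_mat n n" using H unfolding hermitian_mat_def by (rule conjunct1)
  obtain v where v: "v \<in> carrier_vec n" "v \<noteq> 0\<^sub>v n" "A *\<^sub>v v = e \<cdot>\<^sub>v v"
    using eigenvalueE[OF e A] .
  define S where "S = (\<Sum>i<n. cnj (v $ i) * v $ i)"
  define Q where "Q = (\<Sum>i<n. \<Sum>k<n. cnj (v $ i) * A $$ (i,k) * v $ k)"
  have row: "(\<Sum>k<n. A $$ (i,k) * v $ k) = e * v $ i" if "i < n" for i
  proof -
    have "(\<Sum>k<n. A $$ (i,k) * v $ k) = (A *\<^sub>v v) $ i"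
      by (rule index_mult_mat_vec_sum[OF A v(1) that, symmetric])
    also have "\<dots> = (e \<cdot>\<^sub>v v) $ i" by (simp only: v(3))
    also have "\<dots> = e * v $ i" using v(1) that by (intro index_smult_vec) auto
    finally show ?thesis .
  qed
  have "Q = (\<Sum>i<n. cnj (v $ i) * (\<Sum>k<n. A $$ (i,k) * v $ k))"
    unfolding Q_def by (simp add: sum_distrib_left mult.assoc)
  also have "\<dots> = e * S"
    unfolding S_def sum_distrib_left[of e] by (intro sum.cong refl) (simp add: row)
  finally have QS: "Q = e * S" .
  have "cnj Q = (\<Sum>i<n. \<Sum>k<n. v $ i * cnj (A $$ (i,k)) * cnj (v $ k))"
    unfolding Q_def by (simp add: cnj_sum)
  also have "\<dots> = (\<Sum>i<n. \<Sum>k<n. v $ i * A $$ (k,i) * cnj (v $ k))"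
    by (intro sum.cong refl) (simp add: hermitian_matD[OF H])
  also have "\<dots> = Q"
    unfolding Q_def by (subst sum.swap) (simp add: mult_ac)
  finally have "cnj Q = Q" .
  moreover have "cnj S = S" unfolding S_def by (simp add: cnj_sum mult.commute)
  moreover have "S \<noteq> 0"
  proof
    assume "S = 0"
    moreover have "S = of_real (\<Sum>i<n. (cmod (v $ i))\<^sup>2)"
      unfolding S_def of_real_sum
      by (intro sum.cong refl) (metis complex_norm_square mult.commute)
    ultimately have "(\<Sum>i<n. (cmod (v $ i))\<^sup>2) = 0"
      by (metis of_real_eq_0_iff)
    hence "\<forall>i<n. v $ i = 0" by (simp add: sum_nonneg_eq_0_iff)
    hence "v = 0\<^sub>v n" using v(1) by (intro eq_vecI) auto
    thus False using v(2) by simp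
  qed
  ultimately show ?thesis using QS by simp
qed

lemma trace_mult_commute:
  fixes A B :: "'a :: comm_ring_1 mat"
  assumes "A \<in> carrier_mat n n" "B \<in> carrier_mat n n"
  shows "(\<Sum>i<n. (A * B) $$ (i,i)) = (\<Sum>i<n. (B * A) $$ (i,i))"
proof -
  have "(\<Sum>i<n. (A * B) $$ (i,i)) = (\<Sum>i<n. \<Sum>k<n. A $$ (i,k) * B $$ (k,i))"
    using assms by (intro sum.cong refl index_mult_mat_sum) auto
  also have "\<dots> = (\<Sum>k<n. \<Sum>i<n. B $$ (k,i) * A $$ (i,k))"
    by (subst sum.swap) (simp add: mult.commute)
  also have "\<dots> = (\<Sum>i<n. (B * A) $$ (i,i))"
    using assms by (intro sum.cong refl index_mult_mat_sum[symmetric]) auto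
  finally show ?thesis .
qed

text \<open>Triangularise \<open>A\<close> to \<open>T\<close>, whose diagonal consists of
  eigenvalues and so vanishes. Then the traces of \<open>T * T\<close> and of the similar
  \<open>A * A\<close> are zero; for Hermitian \<open>A\<close> the latter is the sum of the squared
  moduli of all entries.\<close>

lemma hermitian_nilpotent_eq_0:
  assumes H: "hermitian_mat n A" and spec: "\<And>e. eigenvalue A e \<Longrightarrow> e = 0"
  shows "A = 0\<^sub>m n n"
proof -
  have A: "A \<in> carrier_mat n n" using H unfolding hermitian_mat_def by (rule conjunct1)
  obtain as where "char_poly A = (\<Prod>a\<leftarrow>as. [:- a, 1:])"
    using char_poly_factorized[OF A] by blast
  then obtain T where T: "T \<in> carrier_mat n n" "upper_triangular T" "similar_mat A T"
    using schur_decomposition_exists[OF A] by blast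
  have diag: "T $$ (i,i) = 0" if "i < n" for i
  proof -
    have "T $$ (i,i) \<in> set (diag_mat T)" using that T(1) by (auto simp: diag_mat_def)
    hence "poly (char_poly T) (T $$ (i,i)) = 0"
      unfolding char_poly_upper_triangular[OF T(1,2)]
      by (force simp: poly_prod_list o_def prod_list_zero_iff)
    hence "eigenvalue A (T $$ (i,i))"
      unfolding eigenvalue_root_char_poly[OF A] char_poly_similar[OF T(3)] .
    thus ?thesis by (rule spec)
  qed
  have TT: "(T * T) $$ (i,i) = 0" if i: "i < n" for i
  proof -
    \<comment> \<open>For \<open>i \<noteq> k\<close> one factor lies below the diagonal; for
      \<open>i = k\<close> both lie on it.\<close>
    have "T $$ (i,k) * T $$ (k,i) = 0" if k: "k < n" for k
      using T(1,2) diag[OF i] i k by (cases i k rule: linorder_cases) (auto simp: upper_triangular_def)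
    thus ?thesis unfolding index_mult_mat_sum[OF T(1) T(1) i i] by (intro sum.neutral) simp
  qed
  obtain P Q where wit: "similar_mat_wit A T P Q" using T(3) by (auto simp: similar_mat_def)
  have P: "P \<in> carrier_mat n n" and Q: "Q \<in> carrier_mat n n" and QP: "Q * P = 1\<^sub>m n"
    and APQ: "A = P * T * Q"
    using wit A by (auto simp: similar_mat_wit_def Let_def)
  have QPT: "Q * (P * T) = T"
    using P Q T(1) QP by (simp flip: assoc_mult_mat[of _ n n _ n _ n])
  have AA: "A * A = P * T * (T * Q)"
  proof -
    have "A * A = P * T * (Q * (P * T) * Q)"
      using P Q T(1) by (simp add: APQ assoc_mult_mat[of _ n n _ n _ n])
    thus ?thesis by (simp only: QPT)
  qed
  have "(\<Sum>i<n. (A * A) $$ (i,i)) = (\<Sum>i<n. (T * Q * (P * T)) $$ (i,i))"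
    unfolding AA using P Q T(1) by (intro trace_mult_commute) auto
  also have "T * Q * (P * T) = T * T"
    using P Q T(1) QPT by (simp add: assoc_mult_mat[of _ n n _ n _ n])
  also have "(\<Sum>i<n. (T * T) $$ (i,i)) = 0" using TT by simp
  finally have "(\<Sum>i<n. (A * A) $$ (i,i)) = 0" .
  moreover have "(\<Sum>i<n. (A * A) $$ (i,i)) = of_real (\<Sum>i<n. \<Sum>k<n. (cmod (A $$ (i,k)))\<^sup>2)"
    unfolding of_real_sum
  proof (intro sum.cong refl)
    fix i assume "i \<in> {..<n}"
    hence i: "i < n" by simp
    have "A $$ (i,k) * A $$ (k,i) = of_real ((cmod (A $$ (i,k)))\<^sup>2)" if "k < n" for k
      using hermitian_matD[OF H i that] by (metis complex_norm_square)
    thus "(A * A) $$ (i,i) = (\<Sum>k<n. of_real ((cmod (A $$ (i,k)))\<^sup>2))"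
      using index_mult_mat_sum[OF A A i i] by simp
  qed
  ultimately have "(\<Sum>i<n. \<Sum>k<n. (cmod (A $$ (i,k)))\<^sup>2) = 0"
    by (simp only: of_real_eq_0_iff)
  hence "\<forall>i<n. \<forall>k<n. A $$ (i,k) = 0" by (simp add: sum_nonneg_eq_0_iff sum_nonneg)
  thus ?thesis using A by (intro eq_matI) auto
qed

text \<open>The matrix \<open>(A - a) (A - b)\<close> is Hermitian because \<open>a\<close> and
  \<open>b\<close> are real, and its only possible eigenvalue is 0, so it vanishes. The identity is
  read off from its entries outside the diagonal.\<close>

lemma hermitian_two_eigenvalues_square:
  assumes H: "hermitian_mat n A" and spec: "spectrum A = {a, b}"
  shows "cnj (a + b) = a + b"
    and "\<lbrakk>i < n; j < n; i \<noteq> j\<rbrakk> \<Longrightarrow>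
           (\<Sum>k<n. A $$ (i,k) * A $$ (k,j)) = (a + b) * A $$ (i,j)"
proof -
  have A: "A \<in> carrier_mat n n" using H unfolding hermitian_mat_def by (rule conjunct1)
  have ev: "eigenvalue A e \<longleftrightarrow> e = a \<or> e = b" for e
    using spec by (auto simp: spectrum_def)
  have ra: "cnj a = a" and rb: "cnj b = b"
    using hermitian_eigenvalue_real[OF H] ev by auto
  show "cnj (a + b) = a + b" by (simp add: ra rb)
  \<comment> \<open>This is \<open>(A - a) (A - b)\<close> written entrywise; \<open>a * b\<close>
    enters on the diagonal only.\<close>
  define B where "B = mat n n (\<lambda>(i,j). (\<Sum>k<n. A $$ (i,k) * A $$ (k,j)) - (a + b) * A $$ (i,j)
     + (if i = j then a * b else 0))"
  have B: "B \<in> carrier_mat n n" by (simp add: B_def)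
  have herm: "hermitian_mat n B"
    unfolding hermitian_mat_def
  proof (intro conjI allI impI B)
    fix i j assume ij: "i < n" "j < n"
    have "cnj (\<Sum>k<n. A $$ (j,k) * A $$ (k,i)) = (\<Sum>k<n. A $$ (k,j) * A $$ (i,k))"
      unfolding cnj_sum using ij by (intro sum.cong refl) (simp add: hermitian_matD[OF H])
    thus "B $$ (i,j) = cnj (B $$ (j,i))"
      using ij by (auto simp: B_def ra rb hermitian_matD[OF H] mult.commute)
  qed
  have "e = 0" if e: "eigenvalue B e" for e
  proof -
    obtain v where v: "v \<in> carrier_vec n" "v \<noteq> 0\<^sub>v n" "B *\<^sub>v v = e \<cdot>\<^sub>v v"
        using eigenvalueE[OF e B] .
    define w where "w = A *\<^sub>v v"
    have w: "w \<in> carrier_vec n" using A v by (simp add: w_def)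
    have Bv: "(A *\<^sub>v w) $ i - (a + b) * w $ i + a * b * v $ i = e * v $ i" if i: "i < n" for i
    proof -
      have "e * v $ i = (B *\<^sub>v v) $ i"
        unfolding v(3) using v(1) i by (intro index_smult_vec(1)[symmetric]) auto
      also have "\<dots> = (\<Sum>j<n. B $$ (i,j) * v $ j)"
        by (rule index_mult_mat_vec_sum[OF B v(1) i])
      also have "\<dots> = (\<Sum>j<n. (\<Sum>k<n. A $$ (i,k) * A $$ (k,j)) * v $ j)
          - (a + b) * (\<Sum>j<n. A $$ (i,j) * v $ j) + (\<Sum>j<n. (if i = j then a * b * v $ j else 0))"
        unfolding sum_distrib_left sum_subtractf[symmetric] sum.distrib[symmetric]
        using i by (intro sum.cong refl) (auto simp: B_def algebra_simps)
      also have "(\<Sum>j<n. (if i = j then a * b * v $ j else 0)) = a * b * v $ i"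
        using i by (subst sum.delta') auto
      also have "(\<Sum>j<n. A $$ (i,j) * v $ j) = w $ i"
        unfolding w_def by (rule index_mult_mat_vec_sum[OF A v(1) i, symmetric])
      also have "(\<Sum>j<n. (\<Sum>k<n. A $$ (i,k) * A $$ (k,j)) * v $ j)
          = (\<Sum>k<n. A $$ (i,k) * (\<Sum>j<n. A $$ (k,j) * v $ j))"
        unfolding sum_distrib_left sum_distrib_right by (subst sum.swap) (simp add: mult.assoc)
      also have "\<dots> = (\<Sum>k<n. A $$ (i,k) * w $ k)"
        unfolding w_def by (intro sum.cong refl) (simp add: index_mult_mat_vec_sum[OF A v(1)])
      also have "\<dots> = (A *\<^sub>v w) $ i"
        by (rule index_mult_mat_vec_sum[OF A w i, symmetric])
      finally show ?thesis by simp
    qed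
    \<comment> \<open>With \<open>r\<close>, \<open>s\<close> the roots of \<open>(x - a) (x - b) - e\<close>, the vector \<open>v\<close> is killed by
      \<open>(A - r) (A - s)\<close>, so one of \<open>r\<close>, \<open>s\<close> is an eigenvalue of \<open>A\<close>.\<close>
    have "degree [:a * b - e, - (a + b), 1:] = 2" by simp
    hence "\<not> constant (poly [:a * b - e, - (a + b), 1:])" by (simp add: constant_degree)
    then obtain r where "poly [:a * b - e, - (a + b), 1:] r = 0"
      using fundamental_theorem_of_algebra by blast
    hence r: "(r - a) * (r - b) = e" by (simp add: algebra_simps)
    define s where "s = a + b - r"
    have s: "(s - a) * (s - b) = e" using r by (simp add: s_def algebra_simps)
    define u where "u = w - s \<cdot>\<^sub>v v"
    have u: "u \<in> carrier_vec n" using w v by (simp add: u_def)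
    \<comment> \<open>Either case yields an eigenvalue of \<open>A\<close>, which is
      \<open>a\<close> or \<open>b\<close>; then the product equal to \<open>e\<close> has a zero
      factor.\<close>
    show "e = 0"
    proof (cases "u = 0\<^sub>v n")
      case True
      have "w = s \<cdot>\<^sub>v v"
      proof (rule eq_vecI)
        fix i assume "i < dim_vec (s \<cdot>\<^sub>v v)"
        hence i: "i < n" using v by simp
        have "u $ i = 0" using True i by simp
        thus "w $ i = (s \<cdot>\<^sub>v v) $ i" using i v w by (simp add: u_def)
      qed (use v w in auto)
      hence "eigenvalue A s" unfolding w_def by (rule eigenvalueI[OF A v(1,2)])
      thus ?thesis using ev s by auto
    next
      case False
      have "A *\<^sub>v u = r \<cdot>\<^sub>v u"
      proof (rule eq_vecI)
        fix i assume "i < dim_vec (r \<cdot>\<^sub>v u)"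
        hence i: "i < n" using u by simp
        have "(A *\<^sub>v u) $ i = (A *\<^sub>v w) $ i - s * w $ i"
        proof -
          have "A *\<^sub>v u = A *\<^sub>v w - s \<cdot>\<^sub>v w"
            using A v w unfolding u_def
            by (simp add: mult_minus_distrib_mat_vec mult_mat_vec w_def)
          thus ?thesis using A w i by simp
        qed
        also have "\<dots> = r * (w $ i - s * v $ i)"
          using Bv[OF i] by (simp add: s_def r[symmetric] algebra_simps)
        finally show "(A *\<^sub>v u) $ i = (r \<cdot>\<^sub>v u) $ i" using i v w by (simp add: u_def)
      qed (use A u in auto)
      hence "eigenvalue A r" by (rule eigenvalueI[OF A u False])
      thus ?thesis using ev r by auto
    qed
  qed
  hence B0: "B = 0\<^sub>m n n" by (rule hermitian_nilpotent_eq_0[OF herm])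
  show "(\<Sum>k<n. A $$ (i,k) * A $$ (k,j)) = (a + b) * A $$ (i,j)"
    if "i < n" "j < n" "i \<noteq> j"
  proof -
    have "B $$ (i,j) = 0" using B0 that by simp
    thus ?thesis using that by (simp add: B_def)
  qed
qed

section \<open>Hermitian weights of oriented graphs\<close>

text \<open>The matrix entry indexed by vertices instead of list positions, so that the counting is
  free of the enumeration.\<close>

definition arc_weight :: "complex \<Rightarrow> ('a \<Rightarrow> 'a \<Rightarrow> bool) \<Rightarrow> 'a \<Rightarrow> 'a \<Rightarrow> complex" where
  "arc_weight \<sigma> E u v = (if E u v then \<sigma> else if E v u then cnj \<sigma> else 0)"

lemma no_common_neighbour:
  assumes unit: "\<sigma> * cnj \<sigma> = 1" and pos: "Re (\<sigma>\<^sup>2) > 0" and fin: "finite V"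
    and zero: "(\<Sum>k\<in>V. arc_weight \<sigma> E u k * arc_weight \<sigma> E k v) = 0"
    and k: "k \<in> V" "E u k \<or> E k u"
  shows "\<not> E k v \<and> \<not> E v k"
proof -
  let ?w = "arc_weight \<sigma> E"
  have unit': "cnj \<sigma> * \<sigma> = 1" using unit by (simp add: mult.commute)
  have sq: "Re (\<sigma> * \<sigma>) > 0" using pos by (simp add: power2_eq_square)
  have csq: "Re (cnj \<sigma> * cnj \<sigma>) > 0" using sq by simp
  \<comment> \<open>The product is \<open>\<sigma> * \<sigma>\<close>, its conjugate or
    \<open>\<sigma> * cnj \<sigma> = 1\<close>, according to the directions of the two
    edges.\<close>
  have walk_pos: "Re (?w u x * ?w x v) > 0" if "E u x \<or> E x u" "E x v \<or> E v x" for x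
    using that sq csq unit unit' by (auto simp: arc_weight_def simp del: times_complex.sel)
  have walk_nonneg: "Re (?w u x * ?w x v) \<ge> 0" for x
  proof (cases "(E u x \<or> E x u) \<and> (E x v \<or> E v x)")
    case True
    thus ?thesis using walk_pos[of x] by linarith
  qed (auto simp: arc_weight_def)
  have "(\<Sum>x\<in>V. Re (?w u x * ?w x v)) = 0"
    using zero by (metis Re_sum zero_complex.sel(1))
  hence "Re (?w u k * ?w k v) = 0"
    using walk_nonneg k(1) by (simp only: sum_nonneg_eq_0_iff[OF fin])
  thus ?thesis using walk_pos[of k] k(2) by force
qed

text \<open>
  Sum the imaginary part of \<open>w u k * w k v * w v u\<close> over all arcs \<open>u \<rightarrow> v\<close> and all \<open>k\<close>.
  A transitive triangle is seen once from its long arc, contributing \<open>Im \<sigma>\<close>, and once from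
  each of its two short arcs, contributing \<open>- Im \<sigma>\<close>; a cyclic triangle contributes
  \<open>- Im (\<sigma> ^ 3)\<close> from each arc. So every triangle makes the total negative.
\<close>
lemma no_triangles:
  assumes unit: "\<sigma> * cnj \<sigma> = 1" and im: "Im \<sigma> > 0" and im3: "Im (\<sigma> ^ 3) > 0"
    and fin: "finite V" and asym: "\<And>u v. E u v \<Longrightarrow> \<not> E v u"
    and real_ratio: "\<And>u v. \<lbrakk>u \<in> V; v \<in> V; E u v\<rbrakk> \<Longrightarrow>
           Im ((\<Sum>k\<in>V. arc_weight \<sigma> E u k * arc_weight \<sigma> E k v) * cnj \<sigma>) = 0"
    and V: "u \<in> V" "v \<in> V" "x \<in> V" and uv: "E u v" and ux: "E u x \<or> E x u"
  shows "\<not> E v x \<and> \<not> E x v"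
proof -
  let ?w = "arc_weight \<sigma> E"
  define e where "e u v = (of_bool (E u v) :: real)" for u v
  \<comment> \<open>\<open>T\<close> counts each transitive triangle once, with long arc from
    \<open>i\<close> to \<open>j\<close> and middle vertex \<open>k\<close>; \<open>C\<close> counts
    each cyclic triangle three times, once per starting vertex.\<close>
  define T where "T = (\<Sum>i\<in>V. \<Sum>j\<in>V. \<Sum>k\<in>V. e i j * e i k * e k j)"
  define C where "C = (\<Sum>i\<in>V. \<Sum>j\<in>V. \<Sum>k\<in>V. e i j * e j k * e k i)"
  \<comment> \<open>The four terms are the four ways to orient the two edges at
    \<open>k\<close>.\<close>
  have summand: "e i j * Im (?w i k * ?w k j * cnj \<sigma>)
      = Im \<sigma> * (e i j * e i k * e k j) - Im \<sigma> * (e i j * e i k * e j k)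
        - Im \<sigma> * (e i j * e k i * e k j) - Im (\<sigma> ^ 3) * (e i j * e j k * e k i)" for i j k
  proof -
    have "\<sigma> * \<sigma> * cnj \<sigma> = \<sigma>" "\<sigma> * cnj \<sigma> * cnj \<sigma> = cnj \<sigma>" "cnj \<sigma> * \<sigma> * cnj \<sigma> = cnj \<sigma>"
      using unit by (simp_all add: mult.assoc mult.left_commute)
    hence "Im (\<sigma> * \<sigma> * cnj \<sigma>) = Im \<sigma>" "Im (\<sigma> * cnj \<sigma> * cnj \<sigma>) = - Im \<sigma>"
        "Im (cnj \<sigma> * \<sigma> * cnj \<sigma>) = - Im \<sigma>"
      by (simp_all only: cnj.sel)
    moreover have "Im (cnj \<sigma> * cnj \<sigma> * cnj \<sigma>) = - Im (\<sigma> ^ 3)"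
      by (simp add: power3_eq_cube flip: complex_cnj_mult del: times_complex.sel)
    ultimately show ?thesis
      using asym[of i j] asym[of i k] asym[of k j] asym[of j i] asym[of k i] asym[of j k]
      by (cases "E i j"; cases "E i k"; cases "E k i"; cases "E k j"; cases "E j k")
        (simp_all add: arc_weight_def e_def del: times_complex.sel)
  qed
  have "(\<Sum>i\<in>V. \<Sum>j\<in>V. \<Sum>k\<in>V. e i j * Im (?w i k * ?w k j * cnj \<sigma>)) = 0"
  proof (rule sum.neutral, rule ballI, rule sum.neutral, rule ballI)
    fix i j assume ij: "i \<in> V" "j \<in> V"
    have "(\<Sum>k\<in>V. e i j * Im (?w i k * ?w k j * cnj \<sigma>))
        = e i j * Im ((\<Sum>k\<in>V. ?w i k * ?w k j) * cnj \<sigma>)"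
      by (simp only: sum_distrib_left sum_distrib_right Im_sum)
    also have "\<dots> = 0" using real_ratio[OF ij] by (simp add: e_def del: times_complex.sel)
    finally show "(\<Sum>k\<in>V. e i j * Im (?w i k * ?w k j * cnj \<sigma>)) = 0" .
  qed
  moreover have "(\<Sum>i\<in>V. \<Sum>j\<in>V. \<Sum>k\<in>V. e i j * Im (?w i k * ?w k j * cnj \<sigma>))
      = Im \<sigma> * T - Im \<sigma> * (\<Sum>i\<in>V. \<Sum>j\<in>V. \<Sum>k\<in>V. e i j * e i k * e j k)
        - Im \<sigma> * (\<Sum>i\<in>V. \<Sum>j\<in>V. \<Sum>k\<in>V. e i j * e k i * e k j) - Im (\<sigma> ^ 3) * C"
    unfolding T_def C_def summand by (simp only: sum_subtractf sum_distrib_left)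
  \<comment> \<open>Here \<open>k\<close> is the sink of a transitive triangle, and in the next sum
    its source; renaming the vertices gives \<open>T\<close> both times.\<close>
  moreover have "(\<Sum>i\<in>V. \<Sum>j\<in>V. \<Sum>k\<in>V. e i j * e i k * e j k) = T"
    unfolding T_def
    by (rule sum.cong[OF refl], subst sum.swap) (intro sum.cong refl, simp add: mult_ac)
  moreover have "(\<Sum>i\<in>V. \<Sum>j\<in>V. \<Sum>k\<in>V. e i j * e k i * e k j) = T"
  proof -
    have "(\<Sum>i\<in>V. \<Sum>j\<in>V. \<Sum>k\<in>V. e i j * e k i * e k j)
        = (\<Sum>i\<in>V. \<Sum>k\<in>V. \<Sum>j\<in>V. e i j * e k i * e k j)"
      by (rule sum.cong[OF refl], rule sum.swap)
    also have "\<dots> = (\<Sum>k\<in>V. \<Sum>i\<in>V. \<Sum>j\<in>V. e i j * e k i * e k j)"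
      by (rule sum.swap)
    also have "\<dots> = (\<Sum>k\<in>V. \<Sum>j\<in>V. \<Sum>i\<in>V. e i j * e k i * e k j)"
      by (rule sum.cong[OF refl], rule sum.swap)
    also have "\<dots> = T"
      unfolding T_def by (intro sum.cong refl) (simp add: mult_ac)
    finally show ?thesis .
  qed
  ultimately have "Im \<sigma> * T + Im (\<sigma> ^ 3) * C = 0" by simp
  moreover have "T \<ge> 0" "C \<ge> 0" unfolding T_def C_def e_def by (auto intro!: sum_nonneg)
  ultimately have "T = 0" "C = 0"
    using im im3 by (smt (verit) mult_nonneg_nonneg mult_pos_pos)+
  moreover have "e i j * e i k * e k j \<ge> 0" "e i j * e j k * e k i \<ge> 0" for i j k
    by (simp_all add: e_def)
  ultimately have no: "e i j * e i k * e k j = 0" "e i j * e j k * e k i = 0"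
    if "i \<in> V" "j \<in> V" "k \<in> V" for i j k
    using that fin unfolding T_def C_def
    by (simp add: sum_nonneg_eq_0_iff sum_nonneg, blast)+
  \<comment> \<open>An edge between \<open>v\<close> and \<open>x\<close> would close a triangle on
    the arc from \<open>u\<close> to \<open>v\<close>; the four instances cover the orientations of
    its other two edges.\<close>
  show ?thesis
    using no(1)[OF V(1,2,3)] no(2)[OF V(1,2,3)] no(1)[OF V(1,3,2)] no(1)[OF V(3,2,1)] uv ux
    by (auto simp: e_def split: if_splits)
qed

section \<open>Oriented graphs with two eigenvalues\<close>

lemma spectrum_zero_diagonal_2x2:
  assumes unit: "\<sigma> * cnj \<sigma> = 1" and A: "A \<in> carrier_mat 2 2"
    and entries: "A $$ (0,0) = 0" "A $$ (0,1) = \<sigma>" "A $$ (1,0) = cnj \<sigma>" "A $$ (1,1) = 0"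
  shows "spectrum A = {1, -1}"
proof -
  have row: "(A *\<^sub>v v) $ 0 = \<sigma> * v $ 1" "(A *\<^sub>v v) $ 1 = cnj \<sigma> * v $ 0"
    if "v \<in> carrier_vec 2" for v
    using index_mult_mat_vec_sum[OF A that, of 0] index_mult_mat_vec_sum[OF A that, of 1]
    by (simp_all add: entries[simplified] eval_nat_numeral lessThan_Suc)
  have vec2_eqI: "v = w" if "v \<in> carrier_vec 2" "w \<in> carrier_vec 2" "v $ 0 = w $ 0" "v $ 1 = w $ 1"
    for v w :: "complex vec"
    using that by (intro eq_vecI) (auto simp: less_2_cases_iff)
  have "eigenvalue A e \<longleftrightarrow> e\<^sup>2 = 1" for e
  proof
    assume "eigenvalue A e"
    then obtain v where v: "v \<in> carrier_vec 2" "v \<noteq> 0\<^sub>v 2" "A *\<^sub>v v = e \<cdot>\<^sub>v v"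
      using A by (rule eigenvalueE)
    have 1: "\<sigma> * v $ 1 = e * v $ 0" "cnj \<sigma> * v $ 0 = e * v $ 1"
      using row[OF v(1)] v(1) unfolding v(3) by auto
    have "e\<^sup>2 * v $ 0 = e * (\<sigma> * v $ 1)" by (simp only: 1(1) power2_eq_square mult.assoc)
    also have "\<dots> = \<sigma> * (e * v $ 1)" by (simp add: mult_ac)
    also have "\<dots> = (\<sigma> * cnj \<sigma>) * v $ 0" by (simp only: 1(2)[symmetric] mult.assoc)
    finally have 0: "e\<^sup>2 * v $ 0 = v $ 0" using unit by simp
    show "e\<^sup>2 = 1"
    proof (cases "v $ 0 = 0")
      case True
      with 1 unit have "v $ 1 = 0" by auto
      with True v(1,2) vec2_eqI[of v "0\<^sub>v 2"] show ?thesis by simp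
    qed (use 0 in simp)
  next
    assume e: "e\<^sup>2 = 1"
    \<comment> \<open>The first row of the eigenvector equation holds for this vector with any
      \<open>e\<close>; the second becomes \<open>e * e = 1\<close>.\<close>
    define v where "v = vec 2 (\<lambda>i. if i = 0 then \<sigma> else e)"
    have v: "v \<in> carrier_vec 2" "v $ 0 = \<sigma>" "v $ 1 = e" by (auto simp: v_def)
    show "eigenvalue A e"
    proof (rule eigenvalueI[OF A v(1)])
      show "v \<noteq> 0\<^sub>v 2" using v(2) unit by auto
      show "A *\<^sub>v v = e \<cdot>\<^sub>v v"
        using A v row[OF v(1)] e unit
        by (intro vec2_eqI) (auto simp: power2_eq_square mult.commute)
    qed
  qed
  thus ?thesis by (auto simp: spectrum_def power2_eq_1_iff)
qed

lemma single_arc_spectrum_card: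
  assumes unit: "\<sigma> * cnj \<sigma> = 1" and us: "enumerates_verts us single_arc"
  shows "card (spectrum (hermitian_adjacency_matrix \<sigma> single_arc us)) = 2"
proof -
  let ?A = "hermitian_adjacency_matrix \<sigma> single_arc us"
  have dist: "distinct us" and set: "set us = {0, 1}"
    using us by (auto simp: enumerates_verts_def single_arc_def)
  have len: "length us = 2" using distinct_card[OF dist] set by simp
  then obtain x y where xy: "us = [x, y]"
    by (metis (no_types, lifting) One_nat_def Suc_1 length_0_conv length_Suc_conv)
  have A: "?A \<in> carrier_mat 2 2" by (simp add: hermitian_adjacency_matrix_def len)
  consider "us = [0, 1]" | "us = [1, 0]"
    using dist set xy by (auto simp: doubleton_eq_iff)
  hence "spectrum ?A = {1, -1}"
  proof cases
    case 1
    show ?thesis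
      by (rule spectrum_zero_diagonal_2x2[OF unit A])
        (simp_all add: 1 hermitian_adjacency_matrix_def single_arc_def)
  next
    case 2
    \<comment> \<open>The reversed enumeration exchanges \<open>\<sigma>\<close> and
      \<open>cnj \<sigma>\<close>.\<close>
    have "cnj \<sigma> * cnj (cnj \<sigma>) = 1" using unit by (simp add: mult.commute)
    thus ?thesis
      by (rule spectrum_zero_diagonal_2x2[OF _ A])
        (simp_all add: 2 hermitian_adjacency_matrix_def single_arc_def)
  qed
  thus ?thesis by simp
qed

lemma oriented_graph_single_arc: "oriented_graph single_arc"
  by unfold_locales (auto simp: single_arc_def)

lemma connected_single_arc: "Digraph_Component.connected (with_proj single_arc)"
proof -
  let ?R = "rtrancl_on {0, 1} ({(0, 1)}\<^sup>s) :: nat rel"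
  have "(0, 0) \<in> ?R" "(1, 1) \<in> ?R" by (auto intro: rtrancl_on_refl)
  moreover have "(0, 1) \<in> ?R" "(1, 0) \<in> ?R"
    by (rule rtrancl_on_into_rtrancl_on[OF rtrancl_on_refl]; simp add: symcl_def)+
  ultimately show ?thesis
    unfolding connected_conv by (auto simp: single_arc_def)
qed

section \<open>Uniqueness up to isomorphism\<close>

lemma digraph_iso_single_arcI:
  assumes "pverts D = {u, v}" "u \<noteq> v" "parcs D = {(u, v)}"
  shows "digraph_iso (with_proj D) (with_proj single_arc)"
proof -
  define f where "f = \<lparr> iso_verts = (\<lambda>x. if x = u then 0 else 1 :: nat),
    iso_arcs = (\<lambda>_ :: 'a \<times> 'a. (0 :: nat, 1 :: nat)), iso_head = snd, iso_tail = fst \<rparr>"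
  have "pre_digraph.digraph_isomorphism (with_proj D) f"
    using assms by (auto simp: pre_digraph.digraph_isomorphism_def wf_digraph_def f_def)
  moreover have "with_proj single_arc = app_iso f (with_proj D)"
    using assms by (auto simp: app_iso_def with_proj_def single_arc_def f_def)
  ultimately show ?thesis unfolding digraph_iso_def by blast
qed

lemma two_eigenvalues_single_arc:
  assumes unit: "\<sigma> * cnj \<sigma> = 1" and re2: "Re (\<sigma>\<^sup>2) > 0"
    and im: "Im \<sigma> > 0" and im3: "Im (\<sigma> ^ 3) > 0"
    and D: "oriented_graph D" and conn: "Digraph_Component.connected (with_proj D)"
    and vs: "enumerates_verts vs D"
    and spec: "card (spectrum (hermitian_adjacency_matrix \<sigma> D vs)) = 2"
  shows "digraph_iso (with_proj D) (with_proj single_arc)"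
proof -
  interpret oriented_graph D by fact
  define E where "E u v \<longleftrightarrow> (u, v) \<in> parcs D" for u v
  let ?w = "arc_weight \<sigma> E"
  define n where "n = length vs"
  define A where "A = hermitian_adjacency_matrix \<sigma> D vs"
  have dist: "distinct vs" and set_vs: "set vs = pverts D"
    using vs by (auto simp: enumerates_verts_def)
  have asym: "\<not> E v u" if "E u v" for u v
    using that no_opposite_arcs by (auto simp: E_def)
  have A: "A \<in> carrier_mat n n" by (simp add: A_def hermitian_adjacency_matrix_def n_def)
  have entry: "A $$ (i,j) = ?w (vs ! i) (vs ! j)" if "i < n" "j < n" for i j
    using that by (simp add: A_def hermitian_adjacency_matrix_def arc_weight_def E_def n_def)
  have herm: "hermitian_mat n A"
    unfolding hermitian_mat_def
  proof (intro conjI A allI impI)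
    fix i j assume "i < n" "j < n"
    thus "A $$ (i,j) = cnj (A $$ (j,i))"
      using asym by (auto simp: entry arc_weight_def)
  qed
  obtain a b where ab: "spectrum A = {a, b}"
    using spec by (auto simp: A_def card_2_iff)
  \<comment> \<open>Two eigenvalues force at least two vertices, from which an arc is obtained
    below.\<close>
  have "card (spectrum A) \<le> n" by (rule card_finite_spectrum(2)[OF A])
  hence n2: "n \<ge> 2" using spec by (simp add: A_def)
  have walks: "(\<Sum>k\<in>pverts D. ?w u k * ?w k v) = (a + b) * ?w u v"
    if uv: "u \<in> pverts D" "v \<in> pverts D" "u \<noteq> v" for u v
  proof -
    obtain i j where ij: "i < n" "j < n" "u = vs ! i" "v = vs ! j"
      using uv unfolding set_vs[symmetric] n_def by (metis in_set_conv_nth)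
    have "bij_betw ((!) vs) {..<n} (pverts D)"
      using dist set_vs unfolding n_def by (intro bij_betw_nth) auto
    hence "(\<Sum>k\<in>pverts D. ?w u k * ?w k v) = (\<Sum>k<n. ?w u (vs ! k) * ?w (vs ! k) v)"
      by (rule sum.reindex_bij_betw[symmetric])
    also have "\<dots> = (\<Sum>k<n. A $$ (i,k) * A $$ (k,j))"
      using ij by (intro sum.cong refl) (simp add: entry)
    also have "\<dots> = (a + b) * A $$ (i,j)"
      using ij uv(3) by (intro hermitian_two_eigenvalues_square(2)[OF herm ab]) auto
    finally show ?thesis using ij by (simp add: entry)
  qed
  have real: "Im (a + b) = 0"
    using hermitian_two_eigenvalues_square(1)[OF herm ab] by (metis Reals_cnj_iff complex_is_Real_iff)
  \<comment> \<open>Distinct vertices with a common neighbour are adjacent, so adjacency propagates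
    along paths from \<open>u\<close> in the induction for \<open>complete\<close>.\<close>
  have adj_trans: "E u v \<or> E v u"
    if uv: "u \<in> pverts D" "v \<in> pverts D" "u \<noteq> v" and k: "k \<in> pverts D" "E u k \<or> E k u" "E k v \<or> E v k"
    for u v k
  proof (rule ccontr)
    assume "\<not> (E u v \<or> E v u)"
    hence "(\<Sum>k\<in>pverts D. ?w u k * ?w k v) = 0"
      using walks[OF uv] by (simp add: arc_weight_def)
    from no_common_neighbour[OF unit re2 pair_finite_verts this k(1,2)] k(3) show False by blast
  qed
  have complete: "E u v \<or> E v u" if uv: "u \<in> pverts D" "v \<in> pverts D" "u \<noteq> v" for u v
  proof -
    have "(u, v) \<in> rtrancl_on (pverts D) ((parcs D)\<^sup>s)"
      using conn uv unfolding connected_conv by simp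
    hence "u = v \<or> E u v \<or> E v u"
    proof (induction rule: rtrancl_on_induct)
      case (step y z)
      have "E y z \<or> E z y" using step by (auto simp: symcl_def E_def)
      thus ?case using step adj_trans[of u z y] uv(1) by blast
    qed simp
    thus ?thesis using uv(3) by blast
  qed
  have tri: "\<not> E v x \<and> \<not> E x v"
    if "u \<in> pverts D" "v \<in> pverts D" "x \<in> pverts D" "E u v" "E u x \<or> E x u" for u v x
  proof (rule no_triangles[OF unit im im3 pair_finite_verts asym _ that])
    fix u v assume uv: "u \<in> pverts D" "v \<in> pverts D" "E u v"
    hence "u \<noteq> v" using asym by blast
    hence "(\<Sum>k\<in>pverts D. ?w u k * ?w k v) * cnj \<sigma> = (a + b) * (\<sigma> * cnj \<sigma>)"
      using walks[OF uv(1,2)] uv(3) by (simp add: arc_weight_def mult.assoc)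
    thus "Im ((\<Sum>k\<in>pverts D. ?w u k * ?w k v) * cnj \<sigma>) = 0"
      using real by (simp only: unit mult_1_right)
  qed
  have card: "card (pverts D) \<ge> 2"
    using n2 distinct_card[OF dist] set_vs by (simp add: n_def)
  then obtain p q where pq: "p \<in> pverts D" "q \<in> pverts D" "p \<noteq> q"
    by (metis card_le_Suc0_iff_eq not_less_eq_eq numeral_2_eq_2 pair_finite_verts)
  then obtain u v where uv: "u \<in> pverts D" "v \<in> pverts D" "E u v"
    using complete by blast
  have ne: "u \<noteq> v" using uv asym by blast
  \<comment> \<open>Any other \<open>x\<close> would be adjacent to both \<open>u\<close> and
    \<open>v\<close> and form a triangle.\<close>
  have "x = u \<or> x = v" if x: "x \<in> pverts D" for x
    using complete[OF uv(1) x] complete[OF uv(2) x] tri[OF uv(1,2) x uv(3)] by blast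
  hence verts: "pverts D = {u, v}" using uv by blast
  have "parcs D = {(u, v)}"
  proof (intro equalityI subsetI)
    fix e assume e: "e \<in> parcs D"
    obtain x y where xy: "e = (x, y)" by (cases e)
    have "E x y" using e xy by (simp add: E_def)
    moreover have "x \<in> {u, v}" "y \<in> {u, v}"
      using in_arcsD1 in_arcsD2 e xy verts by auto
    ultimately show "e \<in> {(u, v)}" using asym uv(3) xy by blast
  qed (use uv(3) in \<open>simp add: E_def\<close>)
  thus ?thesis by (rule digraph_iso_single_arcI[OF verts ne])
qed

theorem theorem4p4:
  fixes k :: int and \<sigma>\<^sub>1 :: complex
  assumes "k > 8"
    and "\<sigma>\<^sub>1 = complex_of_real (cos (2 * pi / real_of_int k))
               + \<i> * complex_of_real (sin (2 * pi / real_of_int k))"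
  shows
    "(oriented_graph single_arc \<and> Digraph_Component.connected (with_proj single_arc) \<and>
      (\<forall>us. enumerates_verts us single_arc \<longrightarrow>
         card (spectrum (hermitian_adjacency_matrix \<sigma>\<^sub>1 single_arc us)) = 2)) \<and>
     (\<forall>(D :: 'a pair_pre_digraph) vs.
        oriented_graph D \<and> Digraph_Component.connected (with_proj D) \<and> enumerates_verts vs D \<and>
        card (spectrum (hermitian_adjacency_matrix \<sigma>\<^sub>1 D vs)) = 2 \<longrightarrow>
        digraph_iso (with_proj D) (with_proj single_arc))"
proof -
  define t where "t = 2 * pi / real_of_int k"
  have k: "real_of_int k > 8" using assms(1) by simp
  \<comment> \<open>The bound \<open>k > 8\<close> enters here: it gives
    \<open>2 * t < pi / 2\<close> for the real part of \<open>\<sigma>\<^sub>1\<^sup>2\<close> and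
    \<open>3 * t < pi\<close> for the imaginary part of \<open>\<sigma>\<^sub>1 ^ 3\<close>.\<close>
  have t: "0 < t" "t < pi / 4"
    using k by (auto simp: t_def field_simps)
  have \<sigma>: "\<sigma>\<^sub>1 = cis t"
    unfolding assms(2) t_def by (simp add: complex_eq_iff)
  have unit: "\<sigma>\<^sub>1 * cnj \<sigma>\<^sub>1 = 1" by (simp add: \<sigma> cis_cnj cis_mult)
  have re2: "Re (\<sigma>\<^sub>1\<^sup>2) > 0"
    unfolding \<sigma> DeMoivre using t by (auto intro!: cos_gt_zero_pi)
  have im: "Im \<sigma>\<^sub>1 > 0" unfolding \<sigma> using t by (auto intro!: sin_gt_zero)
  have im3: "Im (\<sigma>\<^sub>1 ^ 3) > 0"
    unfolding \<sigma> DeMoivre using t by (auto intro!: sin_gt_zero)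
  show ?thesis
    using oriented_graph_single_arc connected_single_arc single_arc_spectrum_card[OF unit]
      two_eigenvalues_single_arc[OF unit re2 im im3] by blast
qed

end
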